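(* Let $X$ be a weighted undirected graph with vertices $v_1,\ldots,v_m$ whose associated weighted symmetric digraph $D_X$ satisfies $w(\bar e)=w(e)$ for all edges, let $S_X$ be an orientation of $\mathbb{E}(D_X)$, and let $\alpha:\mathbb{E}(D_X)\to\mathbb{Z}_p^d$ be a voltage assignment. Write $\alpha(S_X)=\{\mathbf{b}_1,\ldots,\mathbf{b}_{N_\alpha}\}$ (distinct). For $1\le k\le N_\alpha$ put $\gamma^{(k)}_{ij}:=\sum_{s\in S_{ij},\,\alpha(s)=\mathbf{b}_k}w(s)$. Let $\mathbf{P}^W$ be the $m\times m$ matrix with entries \[ P^W_{ij}=\gamma^{(1)}_{ij}X_1+\cdots+\gamma^{(N_\alpha)}_{ij}X_{N_\alpha}+\gamma^{(1)}_{ji}Y_1+\cdots+\gamma^{(N_\alpha)}_{ji}Y_{N_\alpha} \] in indeterminates $X_k,Y_k$, let $\mathbf{M}^W:=\mathbf{D}^W(X)-\mathbf{B}^W-\mathbf{C}^W-\mathbf{P}^W$ and $P^W(X_1,\ldots,X_{N_\alpha},Y_1,\ldots,Y_{N_\alpha}):=\det\mathbf{M}^W$. Then \[ Q^W_{X,\alpha}(T_1,\ldots,T_d)=P^W(Q_{\mathbf{b}_1},\ldots,Q_{\mathbf{b}_{N_\alpha}},Q_{-\mathbf{b}_1},\ldots,Q_{-\mathbf{b}_{N_\alpha}}), \] where $Q_{\pm\mathbf{b}_k}:=(1+T_1)^{\pm(\mathbf{b}_k)_1}\cdots(1+T_d)^{\pm(\mathbf{b}_k)_d}-1$.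
   Context: $D_X$ is the symmetric digraph obtained by replacing each undirected edge by a pair of mutually inverse directed edges $e,\bar e$ (with $o(\bar e)=t(e)$), both carrying the weight of the undirected edge (weights in $\bar{\mathbb{Q}}_p$). A voltage assignment satisfies $\alpha(\bar e)=-\alpha(e)$. An orientation is a subset $S_X\subset\mathbb{E}(D_X)$ with $S_X\cap\bar S_X=\emptyset$ and $S_X\cup\bar S_X=\mathbb{E}(D_X)$, where $\bar S_X=\{\bar e:e\in S_X\}$. $S_{ij}=\{s\in S_X:o(s)=v_i,t(s)=v_j\}$. $\mathbf{B}^W=(B^W_{ij})$ with $B^W_{ij}=\sum_{s\in S_{ij}}w(s)$ and $\mathbf{C}^W=(C^W_{ij})$ with $C^W_{ij}=\sum_{s\in S_{ji}}w(s)$. $\mathbf{D}^W(X)$ is diagonal with $i$-th entry $\sum_{e\in\mathbb{E}(D_X),\,o(e)=v_i}w(e)$. With $\tau(\mathbf a)=\prod_i(1+T_i)^{a_i}$, $Q^W_{X,\alpha}:=\det\big(\mathbf{D}^W(X)-(\sum_{e:\,o(e)=v_i,t(e)=v_j}\tau(\alpha(e))w(e))_{ij}\big)$, an element of $K[[T_1,\dots,T_d]]$ for $K$ a finite extension of $\mathbb{Q}_p$ containing the weights. *)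

theory Defs
  imports
    "HOL-Library.Poly_Mapping"
    "HOL-Library.Uprod"
    "HOL-Computational_Algebra.Formal_Power_Series"
    "HOL-Computational_Algebra.Fraction_Field"
    "HOL-Algebra.Algebraic_Closure_Type"
    "Graph_Theory.Bidirected_Digraph"
    "Jordan_Normal_Form.Determinant"
    "Berlekamp_Zassenhaus.Finite_Field"
begin

section \<open>The $p$-adic integers and the algebraic closure of the $p$-adic numbers\<close>

text \<open>
  The prime is \<^term>\<open>CARD('p)\<close>.  A $p$-adic integer is a compatible system of residues modulo
  $p^n$, each given by its representative in $\{0,\dots,p^n-1\}$.
\<close>

typedef (overloaded) ('p :: prime_card) padic_int =
  "{x :: nat \<Rightarrow> int. \<forall>n. x (Suc n) mod int CARD('p) ^ n = x n}"
  morphisms residue Abs_padic_int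
  by (rule exI[of _ "\<lambda>_. 0"]) simp

setup_lifting type_definition_padic_int

lemma mod_power_Suc_mod: "(a mod q ^ Suc n) mod q ^ n = a mod q ^ n" for a q :: int
  by (simp add: mod_mod_cancel)

instantiation padic_int :: (prime_card) comm_ring_1
begin

lift_definition zero_padic_int :: "'a padic_int" is "\<lambda>_. 0" by simp

lift_definition one_padic_int :: "'a padic_int" is "\<lambda>n. 1 mod int CARD('a) ^ n"
  by (rule mod_power_Suc_mod)

lift_definition plus_padic_int :: "'a padic_int \<Rightarrow> 'a padic_int \<Rightarrow> 'a padic_int"
  is "\<lambda>x y n. (x n + y n) mod int CARD('a) ^ n"
  by (metis mod_power_Suc_mod mod_add_eq)

lift_definition uminus_padic_int :: "'a padic_int \<Rightarrow> 'a padic_int"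
  is "\<lambda>x n. (- x n) mod int CARD('a) ^ n"
  by (metis mod_power_Suc_mod mod_minus_eq)

lift_definition minus_padic_int :: "'a padic_int \<Rightarrow> 'a padic_int \<Rightarrow> 'a padic_int"
  is "\<lambda>x y n. (x n - y n) mod int CARD('a) ^ n"
  by (metis mod_power_Suc_mod mod_diff_eq)

lift_definition times_padic_int :: "'a padic_int \<Rightarrow> 'a padic_int \<Rightarrow> 'a padic_int"
  is "\<lambda>x y n. (x n * y n) mod int CARD('a) ^ n"
  by (metis mod_power_Suc_mod mod_mult_eq)

instance
proof
  fix a b c :: "'a padic_int"
  have red: "x n mod int CARD('a) ^ n = x n"
    if "\<forall>n. x (Suc n) mod int CARD('a) ^ n = x n" for x n
    using that by (metis mod_mod_trivial)
  show "a + b + c = a + (b + c)" by transfer (auto simp: fun_eq_iff mod_simps algebra_simps)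
  show "a + b = b + a" by transfer (auto simp: fun_eq_iff algebra_simps)
  show "0 + a = a" by transfer (auto simp: fun_eq_iff red)
  show "- a + a = 0" by transfer (auto simp: fun_eq_iff mod_simps)
  show "a - b = a + - b" by transfer (auto simp: fun_eq_iff mod_simps)
  show "a * b * c = a * (b * c)" by transfer (auto simp: fun_eq_iff mod_simps algebra_simps)
  show "a * b = b * a" by transfer (auto simp: fun_eq_iff algebra_simps)
  show "1 * a = a" by transfer (auto simp: fun_eq_iff mod_simps red)
  show "(a + b) * c = a * c + b * c" by transfer (auto simp: fun_eq_iff mod_simps algebra_simps)
  show "(0 :: 'a padic_int) \<noteq> 1"
  proof
    assume "(0 :: 'a padic_int) = 1"
    then have "1 mod int CARD('a) ^ 1 = 0" by transfer (metis)
    moreover have "CARD('a) > 1" using prime_card prime_gt_1_nat by blast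
    ultimately show False by simp
  qed
qed

end

lemma residue_mod: "residue x n mod int CARD('p) ^ n = residue (x :: 'p :: prime_card padic_int) n"
  using residue[of x] by (auto) (metis mod_mod_trivial)

lemma residue_mod_le:
  assumes "n \<le> k"
  shows "residue (x :: 'p :: prime_card padic_int) k mod int CARD('p) ^ n = residue x n"
  using assms
proof (induction k rule: dec_induct)
  case base
  show ?case by (rule residue_mod)
next
  case (step k)
  have "residue x (Suc k) mod int CARD('p) ^ k = residue x k" using residue[of x] by auto
  then show ?case using step by (metis le_imp_power_dvd mod_mod_cancel)
qed

lemma residue_of_nat: "residue (of_nat k :: 'p :: prime_card padic_int) n = int k mod int CARD('p) ^ n"
proof (induction k)
  case 0
  show ?case by (simp add: zero_padic_int.rep_eq)
next
  case (Suc k)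
  then show ?case by (simp add: plus_padic_int.rep_eq one_padic_int.rep_eq mod_simps)
qed

instance padic_int :: (prime_card) idom
proof
  fix a b :: "'a padic_int"
  let ?p = "int CARD('a)"
  assume "a \<noteq> 0" "b \<noteq> 0"
  then obtain n k where nk: "residue a n \<noteq> 0" "residue b k \<noteq> 0"
    by (metis (no_types, lifting) ext residue_inject zero_padic_int.rep_eq)
  have p: "prime ?p" using prime_card by simp
  let ?A = "residue a (n + k)" and ?B = "residue b (n + k)"
  have "\<not> ?p ^ n dvd ?A" "\<not> ?p ^ k dvd ?B"
    using nk residue_mod_le[of n "n + k" a] residue_mod_le[of k "n + k" b] by auto
  then have "multiplicity ?p ?A < n" "multiplicity ?p ?B < k" "?A \<noteq> 0" "?B \<noteq> 0"
    by (meson multiplicity_dvd' not_le, meson multiplicity_dvd' not_le, auto)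
  then have "\<not> ?p ^ (n + k) dvd ?A * ?B"
    using p by (subst power_dvd_iff_le_multiplicity)
      (auto simp: prime_elem_multiplicity_mult_distrib)
  then have "residue (a * b) (n + k) \<noteq> 0"
    by (auto simp: times_padic_int.rep_eq)
  then show "a * b \<noteq> 0" by (auto simp: zero_padic_int.rep_eq)
qed

instance padic_int :: (prime_card) ring_char_0
proof
  show "inj (of_nat :: nat \<Rightarrow> 'a padic_int)"
  proof
    fix i j :: nat
    assume eq: "(of_nat i :: 'a padic_int) = of_nat j"
    have p: "CARD('a) > 1" using prime_card prime_gt_1_nat by blast
    have "k < CARD('a) ^ (i + j)" if "k \<le> i + j" for k
      using less_exp[of "i + j"] power_mono[of 2 "CARD('a)" "i + j"] p that by linarith
    then have "int k mod int CARD('a) ^ (i + j) = int k" if "k \<le> i + j" for k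
      using that by (metis mod_less of_nat_mod of_nat_power)
    then show "i = j"
      using residue_of_nat[of i "i + j", where 'p = 'a] residue_of_nat[of j "i + j", where 'p = 'a] eq
      by (metis le_add1 le_add2 of_nat_eq_iff)
  qed
qed

instance fract :: ("{idom, ring_char_0}") field_char_0
proof
  have "(of_nat n :: 'a fract) = Fract (of_nat n) 1" for n
    by (induction n) (auto simp: Zero_fract_def One_fract_def)
  then show "inj (of_nat :: nat \<Rightarrow> 'a fract)"
    by (auto simp: inj_on_def eq_fract)
qed

type_synonym 'p padic = "'p padic_int fract"

type_synonym 'p padic_closure = "'p padic alg_closure"

definition padic_embed :: "'p :: prime_card padic_int \<Rightarrow> 'p padic_closure" where
  "padic_embed a = to_ac (Fract a 1)"

definition finite_padic_extension :: "'p :: prime_card padic_closure set \<Rightarrow> bool" where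
  "finite_padic_extension K \<longleftrightarrow>
     range to_ac \<subseteq> K \<and> subfield K ring_of_type_algebra \<and>
     ring.finite_dimension ring_of_type_algebra (range (to_ac :: 'p padic \<Rightarrow> 'p padic_closure)) K"


section \<open>Formal power series in several variables\<close>

text \<open>A power series in variables indexed by \<^typ>\<open>'d\<close> is the family of its coefficients, indexed by
  monomials (finitely supported exponent vectors).\<close>

typedef ('d, 'k) mfps = "UNIV :: (('d \<Rightarrow>\<^sub>0 nat) \<Rightarrow> 'k) set"
  morphisms mcoeff Abs_mfps by simp

setup_lifting type_definition_mfps

definition splits :: "('d \<Rightarrow>\<^sub>0 nat) \<Rightarrow> (('d \<Rightarrow>\<^sub>0 nat) \<times> ('d \<Rightarrow>\<^sub>0 nat)) set" where
  "splits \<mu> = {(\<kappa>, \<eta>). \<kappa> + \<eta> = \<mu>}"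

lemma finite_splits [simp]: "finite (splits \<mu>)"
proof -
  let ?l = "Poly_Mapping.lookup :: ('a \<Rightarrow>\<^sub>0 nat) \<Rightarrow> _"
  let ?k = "Poly_Mapping.keys \<mu>"
  let ?F = "{f. \<forall>x. (x \<in> ?k \<longrightarrow> f x \<in> {..Max (insert 0 (?l \<mu> ` ?k))}) \<and>
                    (x \<notin> ?k \<longrightarrow> f x = (0 :: nat))}"
  have le: "?l \<kappa> x \<le> ?l \<mu> x \<and> ?l \<eta> x \<le> ?l \<mu> x" if "\<kappa> + \<eta> = \<mu>" for \<kappa> \<eta> x
    using that by (auto simp: lookup_add)
  have F: "?l \<nu> \<in> ?F" if "\<And>x. ?l \<nu> x \<le> ?l \<mu> x" for \<nu>
  proof -
    have "?l \<nu> x \<le> Max (insert 0 (?l \<mu> ` ?k))" if "x \<in> ?k" for x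
      by (rule order_trans[OF \<open>?l \<nu> x \<le> ?l \<mu> x\<close>]) (use that in simp)
    moreover have "?l \<nu> x = 0" if "x \<notin> ?k" for x
      using \<open>?l \<nu> x \<le> ?l \<mu> x\<close> that by (simp add: in_keys_iff)
    ultimately show ?thesis by auto
  qed
  have "(\<lambda>(\<kappa>, \<eta>). (?l \<kappa>, ?l \<eta>)) ` splits \<mu> \<subseteq> ?F \<times> ?F"
  proof (rule image_subsetI)
    fix x assume "x \<in> splits \<mu>"
    then have "fst x + snd x = \<mu>" by (auto simp: splits_def)
    then have "?l (fst x) \<in> ?F" "?l (snd x) \<in> ?F" using le by (intro F; blast)+
    then show "(case x of (\<kappa>, \<eta>) \<Rightarrow> (?l \<kappa>, ?l \<eta>)) \<in> ?F \<times> ?F"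
      by (simp add: case_prod_unfold)
  qed
  moreover have "finite ?F"
    by (rule finite_set_of_finite_funs) auto
  moreover have "inj_on (\<lambda>(\<kappa>, \<eta>). (?l \<kappa>, ?l \<eta>)) (splits \<mu>)"
    by (auto simp: inj_on_def)
  ultimately show ?thesis
    by (meson finite_SigmaI finite_imageD finite_subset)
qed

lemma splits_0 [simp]: "splits (0 :: 'd \<Rightarrow>\<^sub>0 nat) = {(0, 0)}"
  by (auto simp: splits_def poly_mapping_eq_iff fun_eq_iff lookup_add)

instantiation mfps :: (type, comm_ring_1) comm_ring_1
begin

lift_definition zero_mfps :: "('a, 'b) mfps" is "\<lambda>_. 0" .

lift_definition one_mfps :: "('a, 'b) mfps" is "\<lambda>\<mu>. if \<mu> = 0 then 1 else 0" .

lift_definition plus_mfps :: "('a, 'b) mfps \<Rightarrow> ('a, 'b) mfps \<Rightarrow> ('a, 'b) mfps"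
  is "\<lambda>f g \<mu>. f \<mu> + g \<mu>" .

lift_definition uminus_mfps :: "('a, 'b) mfps \<Rightarrow> ('a, 'b) mfps"
  is "\<lambda>f \<mu>. - f \<mu>" .

lift_definition minus_mfps :: "('a, 'b) mfps \<Rightarrow> ('a, 'b) mfps \<Rightarrow> ('a, 'b) mfps"
  is "\<lambda>f g \<mu>. f \<mu> - g \<mu>" .

lift_definition times_mfps :: "('a, 'b) mfps \<Rightarrow> ('a, 'b) mfps \<Rightarrow> ('a, 'b) mfps"
  is "\<lambda>f g \<mu>. \<Sum>(\<kappa>, \<eta>) \<in> splits \<mu>. f \<kappa> * g \<eta>" .

instance
proof
  fix a b c :: "('a, 'b) mfps"
  show "a + b + c = a + (b + c)" by transfer (simp add: algebra_simps)
  show "a + b = b + a" by transfer (simp add: algebra_simps)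
  show "0 + a = a" by transfer simp
  show "- a + a = 0" by transfer simp
  show "a - b = a + - b" by transfer simp
  show "(0 :: ('a, 'b) mfps) \<noteq> 1" by transfer (metis zero_neq_one)
  show "(a + b) * c = a * c + b * c"
    by transfer (simp add: algebra_simps sum.distrib case_prod_unfold)
  show "a * b = b * a"
  proof (transfer, rule ext)
    fix a b :: "('a \<Rightarrow>\<^sub>0 nat) \<Rightarrow> 'b" and \<mu>
    show "(\<Sum>(\<kappa>, \<eta>)\<in>splits \<mu>. a \<kappa> * b \<eta>) = (\<Sum>(\<kappa>, \<eta>)\<in>splits \<mu>. b \<kappa> * a \<eta>)"
      by (rule sum.reindex_bij_witness[of _ prod.swap prod.swap])
        (auto simp: splits_def add.commute mult.commute)
  qed
  show "1 * a = a"
  proof (transfer, rule ext)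
    fix a :: "('a \<Rightarrow>\<^sub>0 nat) \<Rightarrow> 'b" and \<mu>
    have "(\<Sum>(\<kappa>, \<eta>)\<in>splits \<mu>. (if \<kappa> = 0 then 1 else 0) * a \<eta>) =
          (\<Sum>(\<kappa>, \<eta>)\<in>{(0 :: 'a \<Rightarrow>\<^sub>0 nat, \<mu>)}. (if \<kappa> = 0 then 1 else 0) * a \<eta>)"
      by (rule sum.mono_neutral_right[OF finite_splits]) (auto simp: splits_def split: if_splits)
    then show "(\<Sum>(\<kappa>, \<eta>)\<in>splits \<mu>. (if \<kappa> = 0 then 1 else 0) * a \<eta>) = a \<mu>" by simp
  qed
  show "a * b * c = a * (b * c)"
  proof (transfer, rule ext)
    fix a b c :: "('a \<Rightarrow>\<^sub>0 nat) \<Rightarrow> 'b" and \<mu>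
    have "(\<Sum>(\<sigma>, \<nu>)\<in>splits \<mu>. (\<Sum>(\<kappa>, \<eta>)\<in>splits \<sigma>. a \<kappa> * b \<eta>) * c \<nu>) =
          (\<Sum>((\<sigma>, \<nu>), (\<kappa>, \<eta>)) \<in> (SIGMA x : splits \<mu>. splits (fst x)). a \<kappa> * b \<eta> * c \<nu>)"
      by (simp add: case_prod_unfold sum_distrib_right sum.Sigma)
    also have "\<dots> = (\<Sum>((\<kappa>, \<sigma>), (\<eta>, \<nu>)) \<in> (SIGMA x : splits \<mu>. splits (snd x)). a \<kappa> * (b \<eta> * c \<nu>))"
      by (rule sum.reindex_bij_witness[of _
            "\<lambda>((\<kappa>, \<sigma>), (\<eta>, \<nu>)). ((\<kappa> + \<eta>, \<nu>), (\<kappa>, \<eta>))"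
            "\<lambda>((\<sigma>, \<nu>), (\<kappa>, \<eta>)). ((\<kappa>, \<eta> + \<nu>), (\<eta>, \<nu>))"])
        (auto simp: splits_def add.assoc mult.assoc)
    also have "\<dots> = (\<Sum>(\<kappa>, \<sigma>)\<in>splits \<mu>. a \<kappa> * (\<Sum>(\<eta>, \<nu>)\<in>splits \<sigma>. b \<eta> * c \<nu>))"
      by (simp add: case_prod_unfold sum_distrib_left sum.Sigma)
    finally show "(\<Sum>(\<sigma>, \<nu>)\<in>splits \<mu>. (\<Sum>(\<kappa>, \<eta>)\<in>splits \<sigma>. a \<kappa> * b \<eta>) * c \<nu>) =
      (\<Sum>(\<kappa>, \<sigma>)\<in>splits \<mu>. a \<kappa> * (\<Sum>(\<eta>, \<nu>)\<in>splits \<sigma>. b \<eta> * c \<nu>))" .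
  qed
qed

end

lift_definition mfps_const :: "'k :: zero \<Rightarrow> ('d, 'k) mfps"
  is "\<lambda>c \<mu>. if \<mu> = 0 then c else 0" .

text \<open>The power series $f(T_i)$ for a power series $f$ in one variable.\<close>

lift_definition mfps_of_fps :: "'d \<Rightarrow> 'k :: zero fps \<Rightarrow> ('d, 'k) mfps"
  is "\<lambda>i f \<mu>. if Poly_Mapping.keys \<mu> \<subseteq> {i} then fps_nth f (Poly_Mapping.lookup \<mu> i) else 0" .

definition mfps_over :: "'k set \<Rightarrow> ('d, 'k) mfps set" where
  "mfps_over K = {f. \<forall>\<mu>. mcoeff f \<mu> \<in> K}"

text \<open>
  For a $p$-adic integer $a$, $(1+T)^a$ is the binomial series $\sum_n \binom{a}{n} T^n$.
  The voltage group $\mathbb{Z}_p^d$ is \<^typ>\<open>'d \<Rightarrow> 'p padic_int\<close> with \<^term>\<open>CARD('d) = d\<close>.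
\<close>

definition tau_series :: "('d :: finite \<Rightarrow> 'p :: prime_card padic_int) \<Rightarrow> ('d, 'p padic_closure) mfps" where
  "tau_series a = (\<Prod>i\<in>UNIV. mfps_of_fps i (fps_binomial (padic_embed (a i))))"


section \<open>Polynomials in the indeterminates $X_k$, $Y_k$\<close>

datatype indet = IndX nat | IndY nat

type_synonym ('x, 'k) mpoly = "('x \<Rightarrow>\<^sub>0 nat) \<Rightarrow>\<^sub>0 'k"

definition mpoly_const :: "'k :: zero \<Rightarrow> ('x, 'k) mpoly" where
  "mpoly_const c = Poly_Mapping.single 0 c"

definition mpoly_var :: "'x \<Rightarrow> ('x, 'k :: zero_neq_one) mpoly" where
  "mpoly_var x = Poly_Mapping.single (Poly_Mapping.single x 1) 1"

definition mpoly_eval :: "('k :: zero \<Rightarrow> 'r :: comm_ring_1) \<Rightarrow> ('x \<Rightarrow> 'r) \<Rightarrow> ('x, 'k) mpoly \<Rightarrow> 'r" where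
  "mpoly_eval h g f = (\<Sum>\<mu>\<in>Poly_Mapping.keys f.
     h (Poly_Mapping.lookup f \<mu>) * (\<Prod>x\<in>Poly_Mapping.keys \<mu>. g x ^ Poly_Mapping.lookup \<mu> x))"


section \<open>Weighted undirected graphs and their symmetric digraphs\<close>

text \<open>Loops and multiple edges are allowed.\<close>

record ('v, 'e, 'k) wgraph =
  uverts :: "'v set"
  uedges :: "'e set"
  uends :: "'e \<Rightarrow> 'v uprod"
  uweight :: "'e \<Rightarrow> 'k"

definition wf_wgraph :: "('v, 'e, 'k) wgraph \<Rightarrow> bool" where
  "wf_wgraph \<Gamma> \<longleftrightarrow> finite (uverts \<Gamma>) \<and> finite (uedges \<Gamma>) \<and>
     (\<forall>e\<in>uedges \<Gamma>. set_uprod (uends \<Gamma> e) \<subseteq> uverts \<Gamma>)"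

text \<open>
  \<^term>\<open>D\<close>, with arc reversal \<^term>\<open>arev\<close> and arc weights \<^term>\<open>w\<close>, arises from \<^term>\<open>\<Gamma>\<close> by
  replacing each edge by a pair of mutually inverse arcs; \<^term>\<open>\<pi>\<close> sends an arc to the edge it comes
  from.  The two arcs are distinct even if the edge is a loop (part of
  \<^const>\<open>bidirected_digraph\<close>).
\<close>

definition symmetric_digraph_of ::
  "('v, 'e, 'k) wgraph \<Rightarrow> ('v, 'a) pre_digraph \<Rightarrow> ('a \<Rightarrow> 'a) \<Rightarrow> ('a \<Rightarrow> 'k) \<Rightarrow> bool" where
  "symmetric_digraph_of \<Gamma> D arev w \<longleftrightarrow>
     bidirected_digraph D arev \<and> verts D = uverts \<Gamma> \<and>
     (\<exists>\<pi>. \<pi> ` arcs D = uedges \<Gamma> \<and>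
        (\<forall>a\<in>arcs D. \<forall>b\<in>arcs D. \<pi> a = \<pi> b \<longleftrightarrow> b = a \<or> b = arev a) \<and>
        (\<forall>a\<in>arcs D. uends \<Gamma> (\<pi> a) = Upair (tail D a) (head D a) \<and> w a = uweight \<Gamma> (\<pi> a)))"

lemma symmetric_digraph_of_exists:
  fixes \<Gamma> :: "('v, 'e, 'k) wgraph"
  assumes "wf_wgraph \<Gamma>"
  shows "\<exists>(D :: ('v, 'e \<times> bool) pre_digraph) arev w. symmetric_digraph_of \<Gamma> D arev w"
proof -
  have "\<exists>u v. uends \<Gamma> e = Upair u v" for e by (metis uprod_exhaust)
  then obtain s t where st: "uends \<Gamma> e = Upair (s e) (t e)" for e by metis
  define D :: "('v, 'e \<times> bool) pre_digraph" where
    "D = \<lparr>verts = uverts \<Gamma>, arcs = uedges \<Gamma> \<times> UNIV,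
          tail = (\<lambda>(e, c). if c then s e else t e), head = (\<lambda>(e, c). if c then t e else s e)\<rparr>"
  define arev where "arev = (\<lambda>(e, c). if e \<in> uedges \<Gamma> then (e, \<not> c) else (e, c))"
  have "s e \<in> uverts \<Gamma>" "t e \<in> uverts \<Gamma>" if "e \<in> uedges \<Gamma>" for e
    using assms that st[of e] by (auto simp: wf_wgraph_def)
  then have "bidirected_digraph D arev"
    by unfold_locales (auto simp: D_def arev_def split: if_splits)
  moreover have "fst ` arcs D = uedges \<Gamma>" by (auto simp: D_def image_iff)
  ultimately have "symmetric_digraph_of \<Gamma> D arev (\<lambda>a. uweight \<Gamma> (fst a))"
    unfolding symmetric_digraph_of_def
    by (intro conjI exI[of _ fst]) (auto simp: D_def arev_def st Upair_inject)
  then show ?thesis by blast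
qed

definition orientation :: "('v, 'a) pre_digraph \<Rightarrow> ('a \<Rightarrow> 'a) \<Rightarrow> 'a set \<Rightarrow> bool" where
  "orientation D arev S \<longleftrightarrow> S \<subseteq> arcs D \<and> S \<inter> arev ` S = {} \<and> S \<union> arev ` S = arcs D"

definition voltage_assignment ::
  "('v, 'a) pre_digraph \<Rightarrow> ('a \<Rightarrow> 'a) \<Rightarrow> ('a \<Rightarrow> 'd \<Rightarrow> 'p :: prime_card padic_int) \<Rightarrow> bool" where
  "voltage_assignment D arev \<alpha> \<longleftrightarrow> (\<forall>a\<in>arcs D. \<alpha> (arev a) = - \<alpha> a)"


section \<open>The matrices\<close>

text \<open>The vertices $v_1,\dots,v_m$ are \<^term>\<open>v 0\<close>, \dots, \<^term>\<open>v (m - 1)\<close>, and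
  $\mathbf{b}_1,\dots,\mathbf{b}_N$ are \<^term>\<open>b 0\<close>, \dots, \<^term>\<open>b (N - 1)\<close>; the indeterminates are
  shifted accordingly.\<close>

definition arcs_between :: "('v, 'a) pre_digraph \<Rightarrow> 'a set \<Rightarrow> 'v \<Rightarrow> 'v \<Rightarrow> 'a set" where
  "arcs_between D A x y = {a \<in> A. tail D a = x \<and> head D a = y}"

definition D_mat :: "('v, 'a) pre_digraph \<Rightarrow> ('a \<Rightarrow> 'k :: comm_ring_1) \<Rightarrow> nat \<Rightarrow> (nat \<Rightarrow> 'v) \<Rightarrow> 'k mat" where
  "D_mat D w m v = mat m m (\<lambda>(i, j). if i = j then \<Sum>a | a \<in> arcs D \<and> tail D a = v i. w a else 0)"

definition B_mat ::
  "('v, 'a) pre_digraph \<Rightarrow> ('a \<Rightarrow> 'k :: comm_ring_1) \<Rightarrow> 'a set \<Rightarrow> nat \<Rightarrow> (nat \<Rightarrow> 'v) \<Rightarrow> 'k mat" where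
  "B_mat D w S m v = mat m m (\<lambda>(i, j). \<Sum>s\<in>arcs_between D S (v i) (v j). w s)"

definition C_mat ::
  "('v, 'a) pre_digraph \<Rightarrow> ('a \<Rightarrow> 'k :: comm_ring_1) \<Rightarrow> 'a set \<Rightarrow> nat \<Rightarrow> (nat \<Rightarrow> 'v) \<Rightarrow> 'k mat" where
  "C_mat D w S m v = mat m m (\<lambda>(i, j). \<Sum>s\<in>arcs_between D S (v j) (v i). w s)"

definition gamma_coeff ::
  "('v, 'a) pre_digraph \<Rightarrow> ('a \<Rightarrow> 'k :: comm_ring_1) \<Rightarrow> 'a set \<Rightarrow> (nat \<Rightarrow> 'v) \<Rightarrow> ('a \<Rightarrow> 'b) \<Rightarrow> 'b \<Rightarrow>
   nat \<Rightarrow> nat \<Rightarrow> 'k" where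
  "gamma_coeff D w S v \<alpha> c i j = (\<Sum>s | s \<in> arcs_between D S (v i) (v j) \<and> \<alpha> s = c. w s)"

definition P_mat ::
  "('v, 'a) pre_digraph \<Rightarrow> ('a \<Rightarrow> 'k :: comm_ring_1) \<Rightarrow> 'a set \<Rightarrow> nat \<Rightarrow> (nat \<Rightarrow> 'v) \<Rightarrow> ('a \<Rightarrow> 'b) \<Rightarrow>
   nat \<Rightarrow> (nat \<Rightarrow> 'b) \<Rightarrow> (indet, 'k) mpoly mat" where
  "P_mat D w S m v \<alpha> N b = mat m m (\<lambda>(i, j).
     (\<Sum>k<N. mpoly_const (gamma_coeff D w S v \<alpha> (b k) i j) * mpoly_var (IndX k)) +
     (\<Sum>k<N. mpoly_const (gamma_coeff D w S v \<alpha> (b k) j i) * mpoly_var (IndY k)))"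

definition M_mat ::
  "('v, 'a) pre_digraph \<Rightarrow> ('a \<Rightarrow> 'k :: comm_ring_1) \<Rightarrow> 'a set \<Rightarrow> nat \<Rightarrow> (nat \<Rightarrow> 'v) \<Rightarrow> ('a \<Rightarrow> 'b) \<Rightarrow>
   nat \<Rightarrow> (nat \<Rightarrow> 'b) \<Rightarrow> (indet, 'k) mpoly mat" where
  "M_mat D w S m v \<alpha> N b =
     map_mat mpoly_const (D_mat D w m v) - map_mat mpoly_const (B_mat D w S m v)
       - map_mat mpoly_const (C_mat D w S m v) - P_mat D w S m v \<alpha> N b"

definition P_poly ::
  "('v, 'a) pre_digraph \<Rightarrow> ('a \<Rightarrow> 'k :: comm_ring_1) \<Rightarrow> 'a set \<Rightarrow> nat \<Rightarrow> (nat \<Rightarrow> 'v) \<Rightarrow> ('a \<Rightarrow> 'b) \<Rightarrow>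
   nat \<Rightarrow> (nat \<Rightarrow> 'b) \<Rightarrow> (indet, 'k) mpoly" where
  "P_poly D w S m v \<alpha> N b = det (M_mat D w S m v \<alpha> N b)"

definition Q_series ::
  "('v, 'a) pre_digraph \<Rightarrow> ('a \<Rightarrow> 'p :: prime_card padic_closure) \<Rightarrow> nat \<Rightarrow> (nat \<Rightarrow> 'v) \<Rightarrow>
   ('a \<Rightarrow> 'd :: finite \<Rightarrow> 'p padic_int) \<Rightarrow> ('d, 'p padic_closure) mfps" where
  "Q_series D w m v \<alpha> = det (map_mat mfps_const (D_mat D w m v)
     - mat m m (\<lambda>(i, j). \<Sum>a\<in>arcs_between D (arcs D) (v i) (v j). tau_series (\<alpha> a) * mfps_const (w a)))"

fun Q_subst :: "(nat \<Rightarrow> 'd :: finite \<Rightarrow> 'p :: prime_card padic_int) \<Rightarrow> indet \<Rightarrow> ('d, 'p padic_closure) mfps" where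
  "Q_subst b (IndX k) = tau_series (b k) - 1"
| "Q_subst b (IndY k) = tau_series (- b k) - 1"

end

theory Submission
  imports Defs
begin

text \<open>
  Evaluation of polynomials is a ring homomorphism, so it commutes with determinants and the identity
  reduces to one between matrix entries.  The arcs from $v_i$ to $v_j$ are the arcs in $S_{ij}$
  together with the inverses of those in $S_{ji}$.  Grouping them by voltage, an arc of $S_{ij}$ with
  voltage $\mathbf{b}_k$ contributes $\tau(\mathbf{b}_k) w = w + Q_{\mathbf{b}_k} w$: the first
  summand is collected in $\mathbf{B}^W$ and the second in the image of $\mathbf{P}^W$; the inverse
  arcs likewise give $\mathbf{C}^W$ and the terms with $Q_{-\mathbf{b}_k}$.
\<close>

section \<open>Subrings\<close>

lemma ring_of_type_algebra_simps:
  "carrier ring_of_type_algebra = UNIV"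
  "\<zero>\<^bsub>ring_of_type_algebra\<^esub> = 0"
  "\<one>\<^bsub>ring_of_type_algebra\<^esub> = 1"
  "x \<oplus>\<^bsub>ring_of_type_algebra\<^esub> y = x + y"
  "x \<otimes>\<^bsub>ring_of_type_algebra\<^esub> y = x * y"
  by (auto simp: ring_of_type_algebra_def)

lemma a_inv_ring_of_type_algebra:
  "\<ominus>\<^bsub>ring_of_type_algebra\<^esub> x = - (x :: 'a :: comm_ring_1)"
proof -
  interpret R: ring "ring_of_type_algebra :: 'a ring" by (rule ring_from_type_algebra)
  show ?thesis
    by (rule R.minus_equality) (auto simp: ring_of_type_algebra_simps)
qed

text \<open>Translates between the record operations in which the subfield \<open>K\<close> is
  specified and the type-class operations in which weights, power series and determinants are
  written.\<close>

lemma subring_of_type_algebra_iff: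
  fixes H :: "'a :: comm_ring_1 set"
  shows "subring H ring_of_type_algebra \<longleftrightarrow>
    1 \<in> H \<and> (\<forall>x\<in>H. - x \<in> H) \<and> (\<forall>x\<in>H. \<forall>y\<in>H. x * y \<in> H \<and> x + y \<in> H)"
    (is "_ \<longleftrightarrow> ?closed")
proof
  assume "subring H ring_of_type_algebra"
  from subringE(3,5,6,7)[OF this] show ?closed
    by (auto simp: ring_of_type_algebra_simps a_inv_ring_of_type_algebra)
next
  assume ?closed
  then show "subring H ring_of_type_algebra"
    by (intro ring.subringI ring_from_type_algebra)
      (auto simp: ring_of_type_algebra_simps a_inv_ring_of_type_algebra)
qed

context
  fixes H :: "'a :: comm_ring_1 set"
  assumes H: "subring H ring_of_type_algebra"
begin

lemma subring_one: "1 \<in> H"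
  and subring_minus: "x \<in> H \<Longrightarrow> - x \<in> H"
  and subring_add: "x \<in> H \<Longrightarrow> y \<in> H \<Longrightarrow> x + y \<in> H"
  and subring_mult: "x \<in> H \<Longrightarrow> y \<in> H \<Longrightarrow> x * y \<in> H"
  using H by (auto simp: subring_of_type_algebra_iff)

lemma subring_zero: "0 \<in> H"
  using subring_add[OF subring_one subring_minus[OF subring_one]] by simp

lemma subring_diff: "x \<in> H \<Longrightarrow> y \<in> H \<Longrightarrow> x - y \<in> H"
  using subring_add[of x "- y"] subring_minus by simp

lemma subring_sum: "(\<And>x. x \<in> A \<Longrightarrow> f x \<in> H) \<Longrightarrow> sum f A \<in> H"
  by (induction A rule: infinite_finite_induct) (auto intro: subring_zero subring_add)

lemma subring_prod: "(\<And>x. x \<in> A \<Longrightarrow> f x \<in> H) \<Longrightarrow> prod f A \<in> H"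
  by (induction A rule: infinite_finite_induct) (auto intro: subring_one subring_mult)

text \<open>The Leibniz expansion is a signed sum of products of entries, so closure under sums,
  products and negation suffices.\<close>

lemma subring_det:
  assumes "A \<in> carrier_mat n n" "\<And>i j. i < n \<Longrightarrow> j < n \<Longrightarrow> A $$ (i, j) \<in> H"
  shows "det A \<in> H"
  unfolding det_def'[OF assms(1)]
proof (intro subring_sum subring_mult subring_prod)
  fix p i assume "p \<in> {p. p permutes {0..<n}}" "i \<in> {0..<n}"
  then show "A $$ (i, p i) \<in> H"
    using permutes_in_image[of p "{0..<n}" i] by (intro assms(2)) auto
next
  fix p :: "nat \<Rightarrow> nat"
  show "signof p \<in> H"
    by (auto simp: sign_def intro: subring_one subring_minus)
qed

end

section \<open>Power series with coefficients in a subring\<close>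

text \<open>Each coefficient of a product is a finite convolution sum of coefficients of the
  factors, so no closure under limits is required of \<open>K\<close>.\<close>

lemma subring_mfps_over:
  fixes K :: "'k :: comm_ring_1 set"
  assumes "subring K ring_of_type_algebra"
  shows "subring (mfps_over K :: ('d, 'k) mfps set) ring_of_type_algebra"
  unfolding subring_of_type_algebra_iff mfps_over_def
  by (auto simp: one_mfps.rep_eq uminus_mfps.rep_eq times_mfps.rep_eq plus_mfps.rep_eq
      intro!: subring_one[OF assms] subring_zero[OF assms] subring_minus[OF assms]
        subring_sum[OF assms] subring_mult[OF assms] subring_add[OF assms])

lemma mfps_const_in_mfps_over: "mfps_const c \<in> mfps_over K" if "0 \<in> K" "c \<in> K"
  using that by (auto simp: mfps_over_def mfps_const.rep_eq)

text \<open>A binomial coefficient is a product of the terms \<open>a - i\<close> divided by a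
  factorial, and the field embedding \<open>to_ac\<close> respects each of these operations. Hence
  the binomial series of a p-adic number has all its coefficients in the image of the p-adic
  field.\<close>

lemma to_ac_gbinomial:
  "to_ac (a gchoose n) = to_ac (a :: 'a :: field_char_0) gchoose n"
  using to_ac_of_nat[of "fact n", where ?'a = 'a] by (simp add: gbinomial_prod_rev to_ac_prod)

text \<open>Each factor of \<open>tau_series a\<close> has as coefficients 0 and binomial
  coefficients of p-adic numbers; the latter lie in \<open>range to_ac\<close>, hence in
  \<open>K\<close>.\<close>

lemma tau_series_in_mfps_over:
  fixes a :: "'d :: finite \<Rightarrow> 'p :: prime_card padic_int"
  assumes "subring K ring_of_type_algebra" and "range to_ac \<subseteq> K"
  shows "tau_series a \<in> mfps_over K"
proof -
  have "padic_embed x gchoose n \<in> K" for x :: "'p padic_int" and n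
    using assms(2) by (auto simp: padic_embed_def simp flip: to_ac_gbinomial)
  then have "mfps_of_fps i (fps_binomial (padic_embed (a i))) \<in> mfps_over K" for i
    using subring_zero[OF assms(1)] by (auto simp: mfps_over_def mfps_of_fps.rep_eq)
  then show ?thesis
    unfolding tau_series_def by (intro subring_prod[OF subring_mfps_over[OF assms(1)]])
qed

lemma comm_ring_hom_mfps_const:
  "comm_ring_hom (mfps_const :: 'k :: comm_ring_1 \<Rightarrow> ('d, 'k) mfps)"
proof
  fix x y :: 'k
  show "mfps_const (x * y) = (mfps_const x * mfps_const y :: ('d, 'k) mfps)"
  proof (transfer, rule ext)
    fix x y :: 'k and \<mu> :: "'d \<Rightarrow>\<^sub>0 nat"
    show "(if \<mu> = 0 then x * y else 0) =
      (\<Sum>(\<kappa>, \<eta>)\<in>splits \<mu>. (if \<kappa> = 0 then x else 0) * (if \<eta> = 0 then y else 0))"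
    proof (cases "\<mu> = 0")
      case False
      \<comment> \<open>If \<kappa> + \<eta> = \<mu> is nonzero, then \<kappa> and \<eta> are not
        both 0, so every term of the convolution vanishes.\<close>
      then show ?thesis by (auto simp: splits_def intro!: sum.neutral)
    qed simp
  qed
qed (transfer; auto)+

section \<open>Evaluation of polynomials\<close>

text \<open>\<open>mpoly_eval\<close> sums over the support, which differs from polynomial to
  polynomial. Since \<open>h 0 = 0\<close>, the sum may be extended to any larger finite set, so
  that several polynomials can be evaluated over a common index set.\<close>

lemma mpoly_eval_superset:
  assumes "h 0 = 0" "finite A" "Poly_Mapping.keys f \<subseteq> A"
  shows "mpoly_eval h g f = (\<Sum>\<mu>\<in>A. h (Poly_Mapping.lookup f \<mu>) *
    (\<Prod>x\<in>Poly_Mapping.keys \<mu>. g x ^ Poly_Mapping.lookup \<mu> x))"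
  unfolding mpoly_eval_def
  by (rule sum.mono_neutral_left) (use assms in \<open>auto simp: in_keys_iff\<close>)

lemma mpoly_eval_single:
  assumes "h 0 = 0"
  shows "mpoly_eval h g (Poly_Mapping.single \<mu> c) =
    h c * (\<Prod>x\<in>Poly_Mapping.keys \<mu>. g x ^ Poly_Mapping.lookup \<mu> x)"
  by (subst mpoly_eval_superset[where A = "{\<mu>}"]) (auto simp: assms)

text \<open>Exponents outside the support are 0 and contribute factors 1. All three products can
  therefore run over the union of the supports, where the power law applies factor by
  factor.\<close>

lemma monomial_eval_add:
  fixes g :: "'x \<Rightarrow> 'r :: comm_ring_1"
  shows "(\<Prod>x\<in>Poly_Mapping.keys (\<mu> + \<nu>). g x ^ Poly_Mapping.lookup (\<mu> + \<nu>) x) =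
    (\<Prod>x\<in>Poly_Mapping.keys \<mu>. g x ^ Poly_Mapping.lookup \<mu> x) *
    (\<Prod>x\<in>Poly_Mapping.keys \<nu>. g x ^ Poly_Mapping.lookup \<nu> x)"
proof -
  let ?A = "Poly_Mapping.keys \<mu> \<union> Poly_Mapping.keys \<nu>"
  have *: "(\<Prod>x\<in>Poly_Mapping.keys \<kappa>. g x ^ Poly_Mapping.lookup \<kappa> x) =
      (\<Prod>x\<in>?A. g x ^ Poly_Mapping.lookup \<kappa> x)" if "Poly_Mapping.keys \<kappa> \<subseteq> ?A" for \<kappa>
    by (rule prod.mono_neutral_left) (use that in \<open>auto simp: in_keys_iff\<close>)
  show ?thesis
    using keys_add[of \<mu> \<nu>]
    by (subst (1 2 3) *) (auto simp: lookup_add power_add prod.distrib)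
qed

lemma sum_single_lookup:
  "(\<Sum>\<mu>\<in>Poly_Mapping.keys f. Poly_Mapping.single \<mu> (Poly_Mapping.lookup f \<mu>)) = f"
  by (rule poly_mapping_eqI)
    (auto simp: lookup_sum lookup_single when_def in_keys_iff)

lemma mpoly_eval_add:
  assumes "comm_ring_hom h"
  shows "mpoly_eval h g (f + f') = mpoly_eval h g f + mpoly_eval h g f'"
proof -
  interpret comm_ring_hom h by fact
  let ?A = "Poly_Mapping.keys f \<union> Poly_Mapping.keys f'"
  have "mpoly_eval h g f'' = (\<Sum>\<mu>\<in>?A. h (Poly_Mapping.lookup f'' \<mu>) *
      (\<Prod>x\<in>Poly_Mapping.keys \<mu>. g x ^ Poly_Mapping.lookup \<mu> x))"
    if "Poly_Mapping.keys f'' \<subseteq> ?A" for f''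
    by (rule mpoly_eval_superset) (use that in auto)
  from this[of f] this[of f'] this[of "f + f'"] show ?thesis
    using keys_add[of f f'] by (simp add: lookup_add hom_add distrib_right sum.distrib)
qed

lemma mpoly_eval_sum:
  assumes "comm_ring_hom h"
  shows "mpoly_eval h g (\<Sum>i\<in>A. f i) = (\<Sum>i\<in>A. mpoly_eval h g (f i))"
  by (induction A rule: infinite_finite_induct)
    (simp_all add: mpoly_eval_add[OF assms] mpoly_eval_def[of _ _ 0])

text \<open>Both factors are expanded into monomials; by additivity only products of two monomials
  remain, and these are settled by \<open>monomial_eval_add\<close>.\<close>

lemma mpoly_eval_mult:
  assumes "comm_ring_hom h"
  shows "mpoly_eval h g (f * f') = mpoly_eval h g f * mpoly_eval h g f'"
proof -
  interpret comm_ring_hom h by fact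
  let ?l = Poly_Mapping.lookup and ?k = Poly_Mapping.keys
  have "mpoly_eval h g (f * f') = mpoly_eval h g
      ((\<Sum>\<mu>\<in>?k f. Poly_Mapping.single \<mu> (?l f \<mu>)) * (\<Sum>\<nu>\<in>?k f'. Poly_Mapping.single \<nu> (?l f' \<nu>)))"
    by (simp only: sum_single_lookup)
  also have "\<dots> = mpoly_eval h g f * mpoly_eval h g f'"
    unfolding sum_product mpoly_eval_sum[OF assms] mult_single mpoly_eval_single[of h, OF hom_zero]
      monomial_eval_add hom_mult
    unfolding mpoly_eval_def sum_product by (simp only: ac_simps)
  finally show ?thesis .
qed

lemma comm_ring_hom_mpoly_eval:
  assumes "comm_ring_hom h"
  shows "comm_ring_hom (mpoly_eval h g)"
proof -
  interpret comm_ring_hom h by fact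
  show ?thesis
  proof
    show "mpoly_eval h g 0 = 0" by (simp add: mpoly_eval_def)
    show "mpoly_eval h g 1 = 1"
      using mpoly_eval_single[of h g 0 1] by (simp flip: single_one)
  qed (simp_all add: mpoly_eval_add mpoly_eval_mult assms)
qed

lemma mpoly_eval_const: "h 0 = 0 \<Longrightarrow> mpoly_eval h g (mpoly_const c) = h c"
  by (simp add: mpoly_const_def mpoly_eval_single)

lemma mpoly_eval_var: "h 0 = 0 \<Longrightarrow> h 1 = 1 \<Longrightarrow> mpoly_eval h g (mpoly_var x) = g x"
  by (simp add: mpoly_var_def mpoly_eval_single)

section \<open>Arcs of the symmetric digraph\<close>

text \<open>The arcs are the union of the fibres of \<pi> over the finitely many edges, and each
  fibre consists of one arc and its inverse.\<close>

lemma finite_arcs_symmetric_digraph: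
  assumes "wf_wgraph \<Gamma>" "symmetric_digraph_of \<Gamma> D arev w"
  shows "finite (arcs D)"
proof -
  obtain \<pi> where \<pi>: "\<pi> ` arcs D = uedges \<Gamma>"
    "\<And>a b. a \<in> arcs D \<Longrightarrow> b \<in> arcs D \<Longrightarrow> \<pi> a = \<pi> b \<longleftrightarrow> b = a \<or> b = arev a"
    using assms(2) unfolding symmetric_digraph_of_def by blast
  have "finite {a \<in> arcs D. \<pi> a = e}" if e: "e \<in> uedges \<Gamma>" for e
  proof -
    have "e \<in> \<pi> ` arcs D" using e \<pi>(1) by simp
    then obtain a where "a \<in> arcs D" "e = \<pi> a" by (elim imageE)
    then have "c = a \<or> c = arev a" if "c \<in> arcs D" "\<pi> c = e" for c
      using \<pi>(2)[of a c] that by simp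
    then have "{a \<in> arcs D. \<pi> a = e} \<subseteq> {a, arev a}" by blast
    then show ?thesis by (rule finite_subset) simp
  qed
  then have "finite (\<Union>e\<in>uedges \<Gamma>. {a \<in> arcs D. \<pi> a = e})"
    using assms(1) by (intro finite_UN_I) (auto simp: wf_wgraph_def)
  also have "(\<Union>e\<in>uedges \<Gamma>. {a \<in> arcs D. \<pi> a = e}) = arcs D"
    unfolding \<pi>(1)[symmetric] by blast
  finally show ?thesis .
qed

lemma symmetric_digraph_weight_in:
  assumes "symmetric_digraph_of \<Gamma> D arev w" "\<forall>e\<in>uedges \<Gamma>. uweight \<Gamma> e \<in> K" "a \<in> arcs D"
  shows "w a \<in> K"
proof -
  obtain \<pi> where "\<pi> ` arcs D = uedges \<Gamma>" "w a = uweight \<Gamma> (\<pi> a)"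
    using assms(1,3) unfolding symmetric_digraph_of_def by blast
  then show ?thesis using assms(2,3) by auto
qed

lemma (in bidirected_digraph) arcs_between_orientation:
  assumes "orientation G arev S"
  shows "arcs_between G (arcs G) x y = arcs_between G S x y \<union> arev ` arcs_between G S y x"
    and "arcs_between G S x y \<inter> arev ` arcs_between G S y x = {}"
proof -
  have S: "S \<subseteq> arcs G" "S \<inter> arev ` S = {}" "S \<union> arev ` S = arcs G"
    using assms by (auto simp: orientation_def)
  then show "arcs_between G S x y \<inter> arev ` arcs_between G S y x = {}"
    by (auto simp: arcs_between_def)
  have "a \<in> arev ` arcs_between G S y x" if "a \<in> arcs_between G (arcs G) x y" "a \<notin> S" for a
  proof -
    from that S obtain s where "s \<in> S" "a = arev s" by (auto simp: arcs_between_def)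
    with that S(1) show ?thesis by (auto simp: arcs_between_def)
  qed
  moreover have "arev ` arcs_between G S y x \<subseteq> arcs_between G (arcs G) x y"
    using S(1) by (auto simp: arcs_between_def)
  ultimately show "arcs_between G (arcs G) x y =
      arcs_between G S x y \<union> arev ` arcs_between G S y x"
    using S(1) by (auto simp: arcs_between_def)
qed

text \<open>On the fibre of \<open>f\<close> over \<open>c\<close>, \<open>F c\<close> equals
  \<open>F (f s)\<close>, and the fibres partition \<open>A\<close>. Only an inclusion in
  \<open>B\<close> is assumed because the arcs between two fixed vertices may miss some of the
  voltages; empty fibres contribute 0.\<close>

lemma sum_group_by_value:
  fixes u F :: "_ \<Rightarrow> 'r :: comm_ring_1"
  assumes "finite A" "bij_betw b {..<N :: nat} B" "f ` A \<subseteq> B"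
  shows "(\<Sum>k<N. (\<Sum>s | s \<in> A \<and> f s = b k. u s) * F (b k)) = (\<Sum>s\<in>A. u s * F (f s))"
proof -
  have "finite B" using assms(2) bij_betw_finite by blast
  have "(\<Sum>k<N. (\<Sum>s | s \<in> A \<and> f s = b k. u s) * F (b k)) =
      (\<Sum>c\<in>B. (\<Sum>s | s \<in> A \<and> f s = c. u s) * F c)"
    using sum.reindex_bij_betw[OF assms(2)] .
  also have "\<dots> = (\<Sum>c\<in>B. \<Sum>s | s \<in> A \<and> f s = c. u s * F (f s))"
    by (auto simp: sum_distrib_right intro!: sum.cong)
  also have "\<dots> = (\<Sum>s\<in>A. u s * F (f s))"
    by (rule sum.group) fact+
  finally show ?thesis .
qed

theorem theorem5p3:
  fixes \<Gamma> :: "('v, 'e, 'p :: prime_card padic_closure) wgraph"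
    and D :: "('v, 'a) pre_digraph"
    and arev :: "'a \<Rightarrow> 'a"
    and w :: "'a \<Rightarrow> 'p padic_closure"
    and K :: "'p padic_closure set"
    and v :: "nat \<Rightarrow> 'v" and m :: nat
    and S :: "'a set"
    and \<alpha> :: "'a \<Rightarrow> 'd :: finite \<Rightarrow> 'p padic_int"
    and b :: "nat \<Rightarrow> 'd \<Rightarrow> 'p padic_int" and N :: nat
  assumes "wf_wgraph \<Gamma>"
    and "bij_betw v {..<m} (uverts \<Gamma>)"
    and "symmetric_digraph_of \<Gamma> D arev w"
    and "\<forall>e\<in>arcs D. w (arev e) = w e"
    and "finite_padic_extension K"
    and "\<forall>e\<in>uedges \<Gamma>. uweight \<Gamma> e \<in> K"
    and "orientation D arev S"
    and "voltage_assignment D arev \<alpha>"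
    and "bij_betw b {..<N} (\<alpha> ` S)"
  shows "Q_series D w m v \<alpha> \<in> mfps_over K \<and>
    Q_series D w m v \<alpha> = mpoly_eval mfps_const (Q_subst b) (P_poly D w S m v \<alpha> N b)"
proof
  have K: "range to_ac \<subseteq> K" "subring K ring_of_type_algebra"
    using assms(5) by (auto simp: finite_padic_extension_def intro: subfieldE(1))
  note KT = subring_mfps_over[OF K(2), where 'd = 'd]
  have wK: "w a \<in> K" if "a \<in> arcs D" for a
    using symmetric_digraph_weight_in[OF assms(3,6) that] .
  have const: "mfps_const c \<in> (mfps_over K :: ('d, _) mfps set)" if "c \<in> K" for c
    using mfps_const_in_mfps_over[OF subring_zero[OF K(2)] that] .
  show "Q_series D w m v \<alpha> \<in> mfps_over K"
    \<comment> \<open>Every matrix entry is built from weights in \<open>K\<close> and series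
      \<open>tau_series\<close>, so it lies in the subring \<open>mfps_over K\<close>, and with the
      entries the determinant does too.\<close>
    unfolding Q_series_def
    by (rule subring_det[OF KT, where n = m])
      (auto simp: D_mat_def arcs_between_def
        intro!: subring_diff[OF KT] subring_sum[OF KT] subring_mult[OF KT]
          subring_sum[OF K(2)] subring_zero[OF K(2)] const wK tau_series_in_mfps_over K)
next
  interpret bidirected_digraph D arev
    using assms(3) by (simp add: symmetric_digraph_of_def)
  let ?c = "mfps_const :: 'p padic_closure \<Rightarrow> ('d, 'p padic_closure) mfps"
  interpret c: comm_ring_hom ?c by (rule comm_ring_hom_mfps_const)
  interpret ev: comm_ring_hom "mpoly_eval ?c (Q_subst b)"
    by (rule comm_ring_hom_mpoly_eval) (rule comm_ring_hom_mfps_const)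
  note eval = mpoly_eval_const[where h = ?c, OF c.hom_zero]
    mpoly_eval_var[where h = ?c, OF c.hom_zero c.hom_one]
  have S: "S \<subseteq> arcs D" using assms(7) by (simp add: orientation_def)
  have fin: "finite (arcs_between D S x y)" for x y
    using finite_subset[OF S finite_arcs_symmetric_digraph[OF assms(1,3)]]
    by (simp add: arcs_between_def)
  \<comment> \<open>\<open>F\<close> will be \<open>tau_series\<close> for the indeterminates X and
    \<open>\<lambda>c. tau_series (- c)\<close> for Y, so \<open>F (b k) - 1\<close> is the
    substituted value. Its \<open>- 1\<close> splits off the plain sum of weights.\<close>
  have gamma: "(\<Sum>k<N. ?c (gamma_coeff D w S v \<alpha> (b k) i j) * (F (b k) - 1)) =
      (\<Sum>s\<in>arcs_between D S (v i) (v j). F (\<alpha> s) * ?c (w s)) -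
      ?c (\<Sum>s\<in>arcs_between D S (v i) (v j). w s)" for i j F
    unfolding gamma_coeff_def c.hom_sum
    by (subst sum_group_by_value[OF fin assms(9), where F = "\<lambda>c. F c - 1"])
      (auto simp: arcs_between_def right_diff_distrib sum_subtractf mult.commute)
  have arcs: "(\<Sum>a\<in>arcs_between D (arcs D) x y. tau_series (\<alpha> a) * ?c (w a)) =
      (\<Sum>s\<in>arcs_between D S x y. tau_series (\<alpha> s) * ?c (w s)) +
      (\<Sum>s\<in>arcs_between D S y x. tau_series (- \<alpha> s) * ?c (w s))" for x y
  proof -
    \<comment> \<open>Reversal is an involution, hence injective, and the sum over inverse arcs can
      be reindexed by arcs of \<open>S\<close>. Symmetry of the weights and antisymmetry of the
      voltages then give the terms with \<open>- \<alpha> s\<close>.\<close>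
    have "(\<Sum>a\<in>arev ` arcs_between D S y x. tau_series (\<alpha> a) * ?c (w a)) =
        (\<Sum>s\<in>arcs_between D S y x. tau_series (\<alpha> (arev s)) * ?c (w (arev s)))"
      by (subst sum.reindex) (auto intro!: inj_on_inverseI[where g = arev])
    also have "\<dots> = (\<Sum>s\<in>arcs_between D S y x. tau_series (- \<alpha> s) * ?c (w s))"
      using assms(4,8) S by (intro sum.cong) (auto simp: arcs_between_def voltage_assignment_def)
    finally show ?thesis
      using arcs_between_orientation[OF assms(7), of x y] fin by (simp add: sum.union_disjoint)
  qed
  \<comment> \<open>At entry (i, j), \<open>gamma\<close> is used for (i, j) with
    \<open>tau_series\<close> and for (j, i) with negated voltages. The weight sums split off there
    cancel the entries of \<open>B_mat\<close> and \<open>C_mat\<close>, and what remains is the sum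
    over all arcs given by \<open>arcs\<close>.\<close>
  have "map_mat ?c (D_mat D w m v)
      - mat m m (\<lambda>(i, j). \<Sum>a\<in>arcs_between D (arcs D) (v i) (v j). tau_series (\<alpha> a) * ?c (w a)) =
    map_mat (mpoly_eval ?c (Q_subst b)) (M_mat D w S m v \<alpha> N b)"
    by (rule eq_matI)
      (auto simp: M_mat_def P_mat_def D_mat_def B_mat_def C_mat_def arcs eval
        ev.hom_minus ev.hom_add ev.hom_sum ev.hom_mult
        gamma[where F = "\<lambda>c. tau_series (- c)"] gamma[where F = tau_series])
  then show "Q_series D w m v \<alpha> = mpoly_eval ?c (Q_subst b) (P_poly D w S m v \<alpha> N b)"
    by (simp add: Q_series_def P_poly_def)
qed

end
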